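(* Consider $y_t=\mathbf{x}_t'\boldsymbol{\alpha}^*+\varepsilon_t$, $t=1,\dots,T$, where $\boldsymbol{\alpha}^*\in\mathbb{R}^n$ is $s$-sparse ($\|\boldsymbol{\alpha}^*\|_0=s<n$), and $\mathbf{x}_t=(x_{1,t},\dots,x_{n,t})'$ and $\varepsilon_t$ are second-order stationary processes with $$x_{i,t}=\phi x_{i,t-1}+u_{i,t}\quad (i=1,\dots,n),\qquad \varepsilon_t=\phi_\varepsilon\varepsilon_{t-1}+\omega_t,$$ $|\phi|<1$, $|\phi_\varepsilon|<1$, $u_{i,t}\sim$ i.i.d. $N(0,1)$ over $t$ for each $i$, $\omega_t\sim$ i.i.d. $N(0,1)$, and the $n+1$ processes $\{x_{1,t}\},\dots,\{x_{n,t}\},\{\varepsilon_t\}$ mutually independent. Let $\mathbf{X}=(\mathbf{x}_1,\dots,\mathbf{x}_T)$ ($n\times T$), $\mathbf{y}=(y_1,\dots,y_T)'$, $\boldsymbol{\varepsilon}=(\varepsilon_1,\dots,\varepsilon_T)'$. Assume that the compatibility constant $\gamma_x^2$ (defined in the context) satisfies $\gamma_x^2>0$. Let $T\ge\left\lfloor\nu\,\frac{1+\phi^2}{1-\phi^2}\right\rceil$ for some $\nu\in\mathbb{Z}^+$. Given a regularization parameter $\ddot\lambda\ge 2\|\mathbf{X}\boldsymbol{\varepsilon}\|_\infty/T>0$, let $$\widehat{\boldsymbol{\alpha}}=\arg\min_{\boldsymbol{\alpha}\in\mathbb{R}^n}\left\{\frac{1}{2T}\|\mathbf{y}-\mathbf{X}'\boldsymbol{\alpha}\|_2^2+\ddot\lambda\|\boldsymbol{\alpha}\|_1\right\}.$$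 Then the following inequalities hold simultaneously with probability at least $1-2e^{-\frac12(c_0-2)\log(n)}$, for some constant $c_0>2$: (a) $\displaystyle \frac1T\left\|\mathbf{X}'(\widehat{\boldsymbol{\alpha}}-\boldsymbol{\alpha}^* )\right\|_2^2\le\frac{4s\ddot\lambda^2}{\gamma_x^2}$; (b) $\displaystyle \left\|\widehat{\boldsymbol{\alpha}}-\boldsymbol{\alpha}^*\right\|_1\le\frac{4s\ddot\lambda}{\gamma_x^2}$.
   Context: Conventions: $\lfloor x\rceil$ is $x$ rounded to the nearest integer; $\|\mathbf{a}\|_0$ is the number of nonzero entries of $\mathbf{a}$; $\|\cdot\|_q$ is the $\ell_q$ norm. Standing assumptions: each row of $\mathbf{X}$ is standardized to have (sample) mean $0$ and variance $1$, and $\frac1T\mathbf{X}\mathbf{X}'\to\mathbf{C}_x$ almost surely, where $\mathbf{C}_x$ is a non-negative definite matrix. Compatibility constant (restricted eigenvalue condition): for $\boldsymbol{\alpha}\in\mathbb{R}^n$ and $S\subseteq\{1,\dots,n\}$ with cardinality $s$, let $\boldsymbol{\alpha}_S$ and $\boldsymbol{\alpha}_{S^c}$ be the restrictions of $\boldsymbol{\alpha}$ to the coordinates in $S$ and in its complement. Then $$\gamma_x^2=\min_{S\subseteq\{1,\dots,n\},\,|S|=s}\ \ \min_{\boldsymbol{\alpha}\in\mathbb{R}^n\setminus\{0\}:\ \|\boldsymbol{\alpha}_{S^c}\|_1\le 3\|\boldsymbol{\alpha}_S\|_1}\ \frac{\boldsymbol{\alpha}'\mathbf{X}\mathbf{X}'\boldsymbol{\alpha}}{T\|\boldsymbol{\alpha}_S\|_2^2}.$$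 *)

theory Defs
  imports "HOL-Probability.Probability"
begin

text \<open>
  The dimension \<open>n\<close> is a bound variable of the result, so vectors of $R^n$ are functions on \<open>nat\<close>
  of which only the values on \<open>{1..n}\<close> are used, and an $n \times T$ matrix is a function \<open>X i t\<close>
  used for \<open>i \<in> {1..n}\<close>, \<open>t \<in> {1..T}\<close>. The norms below take the set of coordinates as an
  argument, so that the norm of the restriction of \<open>v\<close> to \<open>S\<close> is the norm over \<open>S\<close>;
  the Euclidean norm is \<open>L2_set\<close>.
\<close>

definition l0_norm :: "nat set \<Rightarrow> (nat \<Rightarrow> real) \<Rightarrow> nat" where
  "l0_norm S v = card {i \<in> S. v i \<noteq> 0}"

definition l1_norm :: "nat set \<Rightarrow> (nat \<Rightarrow> real) \<Rightarrow> real" where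
  "l1_norm S v = (\<Sum>i\<in>S. \<bar>v i\<bar>)"

definition linf_norm :: "nat set \<Rightarrow> (nat \<Rightarrow> real) \<Rightarrow> real" where
  "linf_norm S v = Max ((\<lambda>i. \<bar>v i\<bar>) ` S)"

text \<open>The products $X v$, $X' a$ and $X X'$.\<close>

definition mat_mult :: "nat \<Rightarrow> (nat \<Rightarrow> nat \<Rightarrow> real) \<Rightarrow> (nat \<Rightarrow> real) \<Rightarrow> nat \<Rightarrow> real" where
  "mat_mult T X v i = (\<Sum>t=1..T. X i t * v t)"

definition mat_trans_mult :: "nat \<Rightarrow> (nat \<Rightarrow> nat \<Rightarrow> real) \<Rightarrow> (nat \<Rightarrow> real) \<Rightarrow> nat \<Rightarrow> real" where
  "mat_trans_mult n X a t = (\<Sum>i=1..n. X i t * a i)"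

definition gram :: "nat \<Rightarrow> (nat \<Rightarrow> nat \<Rightarrow> real) \<Rightarrow> nat \<Rightarrow> nat \<Rightarrow> real" where
  "gram T X i j = (\<Sum>t=1..T. X i t * X j t)"

definition quad_form :: "nat \<Rightarrow> (nat \<Rightarrow> nat \<Rightarrow> real) \<Rightarrow> (nat \<Rightarrow> real) \<Rightarrow> real" where
  "quad_form n Q a = (\<Sum>i=1..n. \<Sum>j=1..n. a i * Q i j * a j)"

definition nonneg_definite :: "nat \<Rightarrow> (nat \<Rightarrow> nat \<Rightarrow> real) \<Rightarrow> bool" where
  "nonneg_definite n Q \<longleftrightarrow>
     (\<forall>i\<in>{1..n}. \<forall>j\<in>{1..n}. Q i j = Q j i) \<and> (\<forall>a. 0 \<le> quad_form n Q a)"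

definition restricted_cone :: "nat \<Rightarrow> nat set \<Rightarrow> (nat \<Rightarrow> real) set" where
  "restricted_cone n S =
     {a. (\<exists>i\<in>{1..n}. a i \<noteq> 0) \<and> l1_norm ({1..n} - S) a \<le> 3 * l1_norm S a}"

text \<open>
  The squared compatibility constant. For \<open>1 \<le> s \<le> n\<close> the infimum over the cone is attained: the
  quotient is positively homogeneous of degree 0 and continuous, and \<open>a\<close> does not vanish on \<open>S\<close>.
  For \<open>s = 0\<close> the cone is empty and the value is unspecified.
\<close>

definition compat_sq :: "nat \<Rightarrow> nat \<Rightarrow> nat \<Rightarrow> (nat \<Rightarrow> nat \<Rightarrow> real) \<Rightarrow> real" where
  "compat_sq n T s X =
     Min ((\<lambda>S. INF a\<in>restricted_cone n S.
              quad_form n (gram T X) a / (real T * (L2_set a S)\<^sup>2))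
          ` {S. S \<subseteq> {1..n} \<and> card S = s})"

definition lasso_objective ::
  "nat \<Rightarrow> nat \<Rightarrow> (nat \<Rightarrow> nat \<Rightarrow> real) \<Rightarrow> (nat \<Rightarrow> real) \<Rightarrow> real \<Rightarrow> (nat \<Rightarrow> real) \<Rightarrow> real" where
  "lasso_objective n T X y l a =
     1 / (2 * real T) * (L2_set (\<lambda>t. y t - mat_trans_mult n X a t) {1..T})\<^sup>2
     + l * l1_norm {1..n} a"

definition sample_mean :: "nat \<Rightarrow> (nat \<Rightarrow> real) \<Rightarrow> real" where
  "sample_mean T v = (\<Sum>t=1..T. v t) / real T"

definition sample_variance :: "nat \<Rightarrow> (nat \<Rightarrow> real) \<Rightarrow> real" where
  "sample_variance T v = (\<Sum>t=1..T. (v t - sample_mean T v)\<^sup>2) / real T"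

definition standardize_rows :: "nat \<Rightarrow> (nat \<Rightarrow> nat \<Rightarrow> real) \<Rightarrow> nat \<Rightarrow> nat \<Rightarrow> real" where
  "standardize_rows T X i t = (X i t - sample_mean T (X i)) / sqrt (sample_variance T (X i))"

definition sample_matrix :: "(nat \<Rightarrow> int \<Rightarrow> 'a \<Rightarrow> real) \<Rightarrow> 'a \<Rightarrow> nat \<Rightarrow> nat \<Rightarrow> real" where
  "sample_matrix x \<omega> i t = x i (int t) \<omega>"

context prob_space
begin

definition covariance_of :: "('a \<Rightarrow> real) \<Rightarrow> ('a \<Rightarrow> real) \<Rightarrow> real" where
  "covariance_of f g = expectation (\<lambda>\<omega>. (f \<omega> - expectation f) * (g \<omega> - expectation g))"

definition second_order_stationary :: "(int \<Rightarrow> 'a \<Rightarrow> real) \<Rightarrow> bool" where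
  "second_order_stationary z \<longleftrightarrow>
     (\<forall>t. random_variable borel (z t) \<and> integrable M (\<lambda>\<omega>. (z t \<omega>)\<^sup>2)) \<and>
     (\<forall>t r. expectation (z t) = expectation (z r)) \<and>
     (\<forall>t r h. covariance_of (z t) (z (t + h)) = covariance_of (z r) (z (r + h)))"

definition iid_std_normal :: "(int \<Rightarrow> 'a \<Rightarrow> real) \<Rightarrow> bool" where
  "iid_std_normal z \<longleftrightarrow>
     indep_vars (\<lambda>_. borel) z UNIV \<and> (\<forall>t. distributed M lborel (z t) std_normal_density)"

end

text \<open>
  The linear model with autoregressive regressors \<open>x i\<close> and errors \<open>e\<close>, driven by the innovations
  \<open>u i\<close> and \<open>w\<close>; \<open>alpha\<close> is the true coefficient vector and \<open>C\<close> the limit of the Gram matrices.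

  \<open>D N \<omega>\<close> is the regressor matrix for sample size \<open>N\<close>. Stationary autoregressive rows with unit
  innovation variance almost surely do not have sample mean exactly 0 and sample variance exactly 1,
  so demanding both of the same matrix would be contradictory. The matrix may therefore be either
  the matrix of the autoregressive observations themselves or the one with standardized rows.
  The response is generated by \<open>D T\<close> in either case.
\<close>

locale sparse_ar_regression = prob_space M
  for M :: "'a measure" +
  fixes n T s nu :: nat
    and phi phi_e :: real
    and x u :: "nat \<Rightarrow> int \<Rightarrow> 'a \<Rightarrow> real"
    and e w :: "int \<Rightarrow> 'a \<Rightarrow> real"
    and D :: "nat \<Rightarrow> 'a \<Rightarrow> nat \<Rightarrow> nat \<Rightarrow> real"
    and C :: "nat \<Rightarrow> nat \<Rightarrow> real"
    and alpha :: "nat \<Rightarrow> real"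
    and y :: "nat \<Rightarrow> 'a \<Rightarrow> real"
  assumes sparse: "l0_norm {1..n} alpha = s" and s_less: "s < n"
    and phi: "\<bar>phi\<bar> < 1" and phi_e: "\<bar>phi_e\<bar> < 1"
    and x_stationary: "\<And>i. i \<in> {1..n} \<Longrightarrow> second_order_stationary (x i)"
    and e_stationary: "second_order_stationary e"
    and x_ar: "\<And>i t. i \<in> {1..n} \<Longrightarrow> AE \<omega> in M. x i t \<omega> = phi * x i (t - 1) \<omega> + u i t \<omega>"
    and e_ar: "\<And>t. AE \<omega> in M. e t \<omega> = phi_e * e (t - 1) \<omega> + w t \<omega>"
    and u_iid: "\<And>i. i \<in> {1..n} \<Longrightarrow> iid_std_normal (u i)"
    and w_iid: "iid_std_normal w"
    and processes_indep:
      "indep_vars (\<lambda>_. Pi\<^sub>M (UNIV :: int set) (\<lambda>_. borel :: real measure))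
         (\<lambda>k \<omega> t. if k = 0 then e t \<omega> else x k t \<omega>) {0..n}"
    and regressors:
      "D = (\<lambda>N \<omega>. sample_matrix x \<omega>) \<or> D = (\<lambda>N \<omega>. standardize_rows N (sample_matrix x \<omega>))"
    and C_nonneg: "nonneg_definite n C"
    and gram_limit:
      "AE \<omega> in M. \<forall>i\<in>{1..n}. \<forall>j\<in>{1..n}. (\<lambda>N. gram N (D N \<omega>) i j / real N) \<longlonglongrightarrow> C i j"
    and response:
      "\<And>t. t \<in> {1..T} \<Longrightarrow> AE \<omega> in M. y t \<omega> = mat_trans_mult n (D T \<omega>) alpha t + e (int t) \<omega>"
    and nu_pos: "0 < nu"
    and T_large: "round (real nu * ((1 + phi\<^sup>2) / (1 - phi\<^sup>2))) \<le> int T"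

text \<open>
  The conditions on the compatibility constant and on the regularization parameter constrain the
  realized sample. \<open>A\<close> is an event on which they hold, and on which \<open>ahat\<close> is some lasso minimizer
  (it need not be unique) for the possibly data-dependent parameter \<open>lam\<close>. Statements about the
  estimator are then made conditionally on \<open>A\<close>; if \<open>A\<close> has probability 1 they are unconditional.
\<close>

definition lasso_event ::
  "nat \<Rightarrow> nat \<Rightarrow> nat \<Rightarrow> (int \<Rightarrow> 'a \<Rightarrow> real) \<Rightarrow> ('a \<Rightarrow> nat \<Rightarrow> nat \<Rightarrow> real) \<Rightarrow> (nat \<Rightarrow> 'a \<Rightarrow> real)
   \<Rightarrow> ('a \<Rightarrow> real) \<Rightarrow> ('a \<Rightarrow> nat \<Rightarrow> real) \<Rightarrow> 'a set \<Rightarrow> bool" where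
  "lasso_event n T s e X y lam ahat A \<longleftrightarrow>
     (\<forall>\<omega>\<in>A. compat_sq n T s (X \<omega>) > 0 \<and>
        lam \<omega> \<ge> 2 * linf_norm {1..n} (mat_mult T (X \<omega>) (\<lambda>t. e (int t) \<omega>)) / real T \<and>
        2 * linf_norm {1..n} (mat_mult T (X \<omega>) (\<lambda>t. e (int t) \<omega>)) / real T > 0 \<and>
        is_arg_min (lasso_objective n T (X \<omega>) (\<lambda>t. y t \<omega>) (lam \<omega>)) (\<lambda>_. True) (ahat \<omega>))"

end

theory Submission
  imports Defs
begin

text \<open>
  Up to a null set the two bounds hold on the whole conditioning event, so they have conditional
  probability 1. With \<open>d = ahat - alpha\<close> and \<open>Q = |X' d|^2 / T\<close>, comparing the objective at \<open>ahat\<close> and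
  at \<open>ahat - theta d\<close> and letting \<open>theta\<close> tend to 0 gives
  \<open>Q \<le> (X e) \<bullet> d / T + l (|alpha|_1 - |ahat|_1)\<close>. The cruder comparison with \<open>theta = 1\<close> only gives
  half of \<open>Q\<close> on the left, which does not suffice for the constant 4 in (a). On the support \<open>S\<close> of
  \<open>alpha\<close> it follows that \<open>Q \<le> 3/2 l |d_S|_1 - 1/2 l |d_Sc|_1\<close>; so \<open>d\<close> lies in the restricted cone,
  and \<open>|d_S|_1 \<le> sqrt s |d_S|_2 \<le> sqrt (s Q / gamma^2)\<close> closes the argument.
\<close>

section \<open>Norm inequalities on coordinate sets\<close>

lemma l1_norm_nonneg: "0 \<le> l1_norm S v"
  by (simp add: l1_norm_def sum_nonneg)

lemma l1_norm_split:
  assumes "finite I" "S \<subseteq> I"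
  shows "l1_norm I v = l1_norm S v + l1_norm (I - S) v"
  using assms by (simp add: l1_norm_def sum.subset_diff add.commute)

lemma L2_set_power2: "(L2_set f S)\<^sup>2 = (\<Sum>t\<in>S. (f t)\<^sup>2)"
  by (simp add: L2_set_def sum_nonneg)

text \<open>Cauchy-Schwarz against the constant function 1.\<close>

lemma l1_norm_power2_le: "(l1_norm S v)\<^sup>2 \<le> real (card S) * (L2_set v S)\<^sup>2"
proof -
  have "l1_norm S v \<le> sqrt (real (card S)) * L2_set v S"
    using L2_set_mult_ineq[where f = "\<lambda>_. 1" and g = v and A = S]
    by (simp add: l1_norm_def L2_set_def)
  then have "(l1_norm S v)\<^sup>2 \<le> (sqrt (real (card S)) * L2_set v S)\<^sup>2"
    by (intro power_mono l1_norm_nonneg)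
  then show ?thesis by (simp add: power_mult_distrib)
qed

lemma sum_mult_le_linf_l1:
  assumes "finite I"
  shows "(\<Sum>i\<in>I. g i * v i) \<le> linf_norm I g * l1_norm I v"
proof -
  have "g i * v i \<le> linf_norm I g * \<bar>v i\<bar>" if "i \<in> I" for i
  proof -
    have "g i * v i \<le> \<bar>g i\<bar> * \<bar>v i\<bar>" by (metis abs_ge_self abs_mult)
    also have "\<dots> \<le> linf_norm I g * \<bar>v i\<bar>"
      using that assms by (intro mult_right_mono) (auto simp: linf_norm_def)
    finally show ?thesis .
  qed
  then show ?thesis by (simp add: l1_norm_def sum_distrib_left sum_mono)
qed

section \<open>The design matrix and its compatibility constant\<close>

text \<open>Moves \<open>X\<close> across the inner product, so that the noise enters only through
  \<open>X e\<close>, the vector whose sup norm the penalty level dominates.\<close>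

lemma mat_mult_adjoint:
  "(\<Sum>t=1..T. e t * mat_trans_mult n X v t) = (\<Sum>i=1..n. mat_mult T X e i * v i)"
  unfolding mat_trans_mult_def mat_mult_def sum_distrib_left sum_distrib_right
  by (subst sum.swap) (simp add: mult_ac)

lemma quad_form_gram: "quad_form n (gram T X) v = (L2_set (mat_trans_mult n X v) {1..T})\<^sup>2"
proof -
  have "(L2_set (mat_trans_mult n X v) {1..T})\<^sup>2
      = (\<Sum>t=1..T. \<Sum>i=1..n. \<Sum>j=1..n. v i * (X i t * X j t) * v j)"
    unfolding L2_set_power2 by (simp add: mat_trans_mult_def power2_eq_square sum_product mult_ac)
  also have "\<dots> = (\<Sum>i=1..n. \<Sum>t=1..T. \<Sum>j=1..n. v i * (X i t * X j t) * v j)"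
    by (rule sum.swap)
  also have "\<dots> = (\<Sum>i=1..n. \<Sum>j=1..n. \<Sum>t=1..T. v i * (X i t * X j t) * v j)"
    by (intro sum.cong refl sum.swap)
  finally show ?thesis
    by (simp add: quad_form_def gram_def sum_distrib_left sum_distrib_right)
qed

text \<open>An infimum of reals lies below its members only when they are bounded below;
  \<open>quad_form_gram\<close> turns the numerator into a square and so supplies the bound
  0.\<close>

lemma compat_sq_le:
  assumes S: "S \<subseteq> {1..n}" "card S = s" and v: "v \<in> restricted_cone n S"
  shows "compat_sq n T s X \<le> quad_form n (gram T X) v / (real T * (L2_set v S)\<^sup>2)"
proof -
  have "{S. S \<subseteq> {1..n} \<and> card S = s} \<subseteq> Pow {1..n}" by blast
  then have fin: "finite {S. S \<subseteq> {1..n} \<and> card S = s}"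
    by (rule finite_subset) simp
  have "compat_sq n T s X
      \<le> (INF a\<in>restricted_cone n S. quad_form n (gram T X) a / (real T * (L2_set a S)\<^sup>2))"
    unfolding compat_sq_def by (rule Min_le) (use fin S in auto)
  also have "\<dots> \<le> quad_form n (gram T X) v / (real T * (L2_set v S)\<^sup>2)"
    by (rule cINF_lower[OF _ v], rule bdd_belowI2[where m = 0]) (simp add: quad_form_gram)
  finally show ?thesis .
qed

section \<open>First-order optimality of the lasso minimizer\<close>

lemma l1_norm_convex:
  assumes "0 \<le> \<theta>" "\<theta> \<le> 1"
  shows "l1_norm I (\<lambda>i. (1 - \<theta>) * a i + \<theta> * b i) \<le> (1 - \<theta>) * l1_norm I a + \<theta> * l1_norm I b"
proof -
  have "\<bar>(1 - \<theta>) * a i + \<theta> * b i\<bar> \<le> (1 - \<theta>) * \<bar>a i\<bar> + \<theta> * \<bar>b i\<bar>" for i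
    using assms abs_triangle_ineq[of "(1 - \<theta>) * a i" "\<theta> * b i"] by (simp add: abs_mult)
  then show ?thesis
    by (simp add: l1_norm_def sum_distrib_left sum_mono flip: sum.distrib)
qed

text \<open>The residual at \<open>a\<close> is \<open>e - X' (a - alpha)\<close>. Expanding its
  square isolates the pure noise term, which cancels when two values of the objective are
  compared.\<close>

lemma lasso_objective_eq:
  assumes y: "\<And>t. t \<in> {1..T} \<Longrightarrow> y t = mat_trans_mult n X alpha t + e t"
  shows "lasso_objective n T X y l a
    = ((\<Sum>t=1..T. (e t)\<^sup>2)
       - 2 * (\<Sum>t=1..T. e t * mat_trans_mult n X (\<lambda>i. a i - alpha i) t)
       + (L2_set (mat_trans_mult n X (\<lambda>i. a i - alpha i)) {1..T})\<^sup>2) / (2 * real T)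
      + l * l1_norm {1..n} a"
proof -
  have "(\<Sum>t=1..T. (y t - mat_trans_mult n X a t)\<^sup>2)
      = (\<Sum>t=1..T. (e t)\<^sup>2 - 2 * (e t * mat_trans_mult n X (\<lambda>i. a i - alpha i) t)
            + (mat_trans_mult n X (\<lambda>i. a i - alpha i) t)\<^sup>2)"
  proof (rule sum.cong[OF refl])
    fix t assume t: "t \<in> {1..T}"
    have "y t - mat_trans_mult n X a t = e t - mat_trans_mult n X (\<lambda>i. a i - alpha i) t"
      using y[OF t] by (simp add: mat_trans_mult_def right_diff_distrib sum_subtractf)
    then show "(y t - mat_trans_mult n X a t)\<^sup>2
        = (e t)\<^sup>2 - 2 * (e t * mat_trans_mult n X (\<lambda>i. a i - alpha i) t)
            + (mat_trans_mult n X (\<lambda>i. a i - alpha i) t)\<^sup>2"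
      by (simp only: power2_diff mult.assoc)
  qed
  then show ?thesis
    by (simp add: lasso_objective_def L2_set_power2 sum.distrib sum_subtractf sum_distrib_left)
qed

lemma lasso_optimality:
  assumes T: "0 < T" and l: "0 \<le> l"
    and y: "\<And>t. t \<in> {1..T} \<Longrightarrow> y t = mat_trans_mult n X alpha t + e t"
    and min: "is_arg_min (lasso_objective n T X y l) (\<lambda>_. True) ahat"
  defines "d \<equiv> \<lambda>i. ahat i - alpha i"
  shows "(L2_set (mat_trans_mult n X d) {1..T})\<^sup>2 / real T
    \<le> (\<Sum>t=1..T. e t * mat_trans_mult n X d t) / real T
       + l * (l1_norm {1..n} alpha - l1_norm {1..n} ahat)"
    (is "?q / _ \<le> ?p / _ + l * ?r")
\<comment> \<open>An arbitrary slack \<open>\<epsilon>\<close> replaces the limit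
  \<open>\<theta>\<close> to 0.\<close>
proof (rule field_le_epsilon)
  define Q where "Q = ?q / real T"
  define P where "P = ?p / real T"
  have Q0: "0 \<le> Q" by (simp add: Q_def)
  have step: "Q \<le> P + l * ?r + \<theta> / 2 * Q" if \<theta>: "0 < \<theta>" "\<theta> \<le> 1" for \<theta>
  proof -
    let ?b = "\<lambda>i. (1 - \<theta>) * ahat i + \<theta> * alpha i"
    have "(\<lambda>i. ?b i - alpha i) = (\<lambda>i. (1 - \<theta>) * d i)"
      by (auto simp: d_def algebra_simps)
    then have M: "mat_trans_mult n X (\<lambda>i. ?b i - alpha i) = (\<lambda>t. (1 - \<theta>) * mat_trans_mult n X d t)"
      by (simp add: fun_eq_iff mat_trans_mult_def sum_distrib_left mult_ac)
    have "lasso_objective n T X y l ?b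
        = ((\<Sum>t=1..T. (e t)\<^sup>2) - 2 * ((1 - \<theta>) * ?p) + (1 - \<theta>)\<^sup>2 * ?q) / (2 * real T)
          + l * l1_norm {1..n} ?b"
      by (simp only: lasso_objective_eq[OF y] M)
        (simp add: L2_set_power2 power_mult_distrib sum_distrib_left mult_ac)
    moreover have "lasso_objective n T X y l ahat
        = ((\<Sum>t=1..T. (e t)\<^sup>2) - 2 * ?p + ?q) / (2 * real T) + l * l1_norm {1..n} ahat"
      by (simp only: lasso_objective_eq[OF y] d_def)
    moreover have "lasso_objective n T X y l ahat \<le> lasso_objective n T X y l ?b"
      using min by (auto simp: is_arg_min_linorder)
    moreover have "l * l1_norm {1..n} ?b
        \<le> l * ((1 - \<theta>) * l1_norm {1..n} ahat + \<theta> * l1_norm {1..n} alpha)"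
      using \<theta> l by (intro mult_left_mono l1_norm_convex) auto
    ultimately have "0 \<le> ((\<Sum>t=1..T. (e t)\<^sup>2) - 2 * ((1 - \<theta>) * ?p) + (1 - \<theta>)\<^sup>2 * ?q) / (2 * real T)
        - ((\<Sum>t=1..T. (e t)\<^sup>2) - 2 * ?p + ?q) / (2 * real T) + l * (\<theta> * ?r)"
      by (simp add: algebra_simps)
    \<comment> \<open>Since
      \<open>(1 - \<theta>)\<^sup>2 - 1 = \<theta>\<^sup>2 - 2 * \<theta>\<close>, a factor
      \<open>\<theta>\<close> comes out and only the remainder \<open>\<theta> / 2 * Q\<close> still
      depends on it.\<close>
    also have "\<dots> = \<theta> * (P + l * ?r + \<theta> / 2 * Q - Q)"
      using T by (simp add: P_def Q_def field_simps power2_eq_square)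
    finally show ?thesis
      using \<theta> by (simp add: zero_le_mult_iff)
  qed
  fix \<epsilon> :: real assume \<epsilon>: "0 < \<epsilon>"
  \<comment> \<open>The cap 1 keeps the combination convex; the denominator \<open>Q + 1\<close> is
    positive even for \<open>Q = 0\<close> and gives
    \<open>\<theta> * Q \<le> \<epsilon>\<close>.\<close>
  define \<theta> where "\<theta> = min 1 (\<epsilon> / (Q + 1))"
  have \<theta>: "0 < \<theta>" "\<theta> \<le> 1" using \<epsilon> Q0 by (auto simp: \<theta>_def)
  have "\<theta> * Q \<le> \<epsilon> / (Q + 1) * Q"
    using Q0 by (intro mult_right_mono) (auto simp: \<theta>_def)
  also have "\<dots> \<le> \<epsilon>"
    using \<epsilon> Q0 by (simp add: field_simps)
  finally have "\<theta> / 2 * Q \<le> \<epsilon>" using \<epsilon> by simp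
  with step[OF \<theta>] show "?q / real T \<le> ?p / real T + l * ?r + \<epsilon>"
    by (simp add: Q_def P_def)
qed

section \<open>Deterministic oracle inequalities\<close>

text \<open>On the support of \<open>a\<close> this is the triangle inequality; off it
  \<open>a\<close> vanishes, so \<open>b - a\<close> and \<open>b\<close> have the same norm
  there.\<close>

lemma l1_norm_diff_le_support:
  assumes "finite I"
  shows "l1_norm I a - l1_norm I b
    \<le> l1_norm {i \<in> I. a i \<noteq> 0} (\<lambda>i. b i - a i) - l1_norm (I - {i \<in> I. a i \<noteq> 0}) (\<lambda>i. b i - a i)"
proof -
  let ?S = "{i \<in> I. a i \<noteq> 0}"
  have "l1_norm ?S a \<le> l1_norm ?S b + l1_norm ?S (\<lambda>i. b i - a i)"
    by (auto simp: l1_norm_def intro!: sum_mono simp flip: sum.distrib)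
  moreover have "l1_norm (I - ?S) a = 0"
    by (auto simp: l1_norm_def intro!: sum.neutral)
  moreover have "l1_norm (I - ?S) (\<lambda>i. b i - a i) = l1_norm (I - ?S) b"
    by (auto simp: l1_norm_def intro!: sum.cong)
  ultimately show ?thesis
    using l1_norm_split[OF assms, of ?S a] l1_norm_split[OF assms, of ?S b] by simp
qed

text \<open>The deterministic core, to be applied to one fixed outcome at a time.\<close>

lemma lasso_oracle_inequalities:
  assumes T: "0 < T" and s: "l0_norm {1..n} alpha = s"
    and y: "\<And>t. t \<in> {1..T} \<Longrightarrow> y t = mat_trans_mult n X alpha t + e t"
    and gamma: "0 < compat_sq n T s X"
    and l: "2 * linf_norm {1..n} (mat_mult T X e) / real T \<le> l" and l_pos: "0 < l"
    and min: "is_arg_min (lasso_objective n T X y l) (\<lambda>_. True) ahat"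
  defines "d \<equiv> \<lambda>i. ahat i - alpha i"
  shows "(L2_set (mat_trans_mult n X d) {1..T})\<^sup>2 / real T \<le> 4 * real s * l\<^sup>2 / compat_sq n T s X"
    and "l1_norm {1..n} d \<le> 4 * real s * l / compat_sq n T s X"
proof -
  define S where "S = {i \<in> {1..n}. alpha i \<noteq> 0}"
  define Q where "Q = (L2_set (mat_trans_mult n X d) {1..T})\<^sup>2 / real T"
  define g where "g = compat_sq n T s X"
  define a where "a = l1_norm S d"
  define b where "b = l1_norm ({1..n} - S) d"
  have S: "S \<subseteq> {1..n}" "card S = s"
    using s by (auto simp: S_def l0_norm_def)
  have g: "0 < g" using gamma by (simp add: g_def)
  have Q0: "0 \<le> Q" by (simp add: Q_def)
  have ab: "0 \<le> a" "0 \<le> b" by (simp_all add: a_def b_def l1_norm_nonneg)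
  have d1: "l1_norm {1..n} d = a + b"
    unfolding a_def b_def by (rule l1_norm_split) (use S in auto)
  have "(\<Sum>t=1..T. e t * mat_trans_mult n X d t) \<le> linf_norm {1..n} (mat_mult T X e) * (a + b)"
    unfolding mat_mult_adjoint d1[symmetric] by (rule sum_mult_le_linf_l1) simp
  also have "\<dots> \<le> (l * real T / 2) * (a + b)"
    using l T ab by (intro mult_right_mono) (auto simp: field_simps)
  finally have "(\<Sum>t=1..T. e t * mat_trans_mult n X d t) / real T \<le> l / 2 * (a + b)"
    using T by (simp add: field_simps)
  moreover have "l * (l1_norm {1..n} alpha - l1_norm {1..n} ahat) \<le> l * (a - b)"
    using l1_norm_diff_le_support[of "{1..n}" alpha ahat] l_pos
    by (intro mult_left_mono) (auto simp: a_def b_def S_def d_def)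
  ultimately have "Q \<le> l / 2 * (a + b) + l * (a - b)"
    using lasso_optimality[OF T less_imp_le[OF l_pos] y min]
    unfolding Q_def d_def by linarith
  then have basic: "Q \<le> l / 2 * (3 * a - b)"
    by (simp add: field_simps)
  \<comment> \<open>The bound on \<open>Q \<ge> 0\<close> cannot be negative; this is where the cone
    constant 3 arises.\<close>
  then have cone: "b \<le> 3 * a"
    using Q0 l_pos by (smt (verit) mult_pos_neg half_gt_zero)
  have compat: "g * a\<^sup>2 \<le> s * Q"
  proof (cases "a = 0")
    case True
    then show ?thesis using Q0 by simp
  next
    case False
    then have "\<exists>i\<in>S. d i \<noteq> 0"
      unfolding a_def l1_norm_def by (metis abs_zero sum.neutral)
    then have "d \<in> restricted_cone n S"
      using S cone by (auto simp: restricted_cone_def a_def b_def)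
    from compat_sq_le[OF S this, of T X]
    have le: "g \<le> Q / (L2_set d S)\<^sup>2"
      by (simp add: g_def Q_def quad_form_gram)
    \<comment> \<open>Division by 0 yields 0, so a vanishing norm would force
      \<open>g \<le> 0\<close>.\<close>
    then have "0 < (L2_set d S)\<^sup>2"
      using g by (cases "L2_set d S = 0") auto
    with le have "g * (L2_set d S)\<^sup>2 \<le> Q"
      by (simp add: field_simps)
    then have "s * (g * (L2_set d S)\<^sup>2) \<le> s * Q"
      by (rule mult_left_mono) simp
    moreover have "g * a\<^sup>2 \<le> g * (s * (L2_set d S)\<^sup>2)"
      using l1_norm_power2_le[of S d] S g by (simp add: a_def)
    ultimately show ?thesis by (simp add: mult_ac)
  qed
  have "Q * (g * Q) \<le> Q * (4 * s * l\<^sup>2)"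
  proof -
    \<comment> \<open>Dropping \<open>b\<close> from \<open>basic\<close> leaves the factor 3/2;
      rounding it up to 2 still gives the constant 4 after squaring.\<close>
    have "Q \<le> 2 * l * a"
      using basic ab l_pos by (smt (verit) mult_left_mono mult_nonneg_nonneg field_sum_of_halves
          ring_class.ring_distribs mult.commute mult.left_commute)
    then have "Q\<^sup>2 \<le> (2 * l * a)\<^sup>2"
      using Q0 by (rule power_mono)
    then have "g * Q\<^sup>2 \<le> g * (2 * l * a)\<^sup>2"
      using g by simp
    also have "\<dots> = 4 * l\<^sup>2 * (g * a\<^sup>2)"
      by (simp add: power_mult_distrib)
    also have "\<dots> \<le> 4 * l\<^sup>2 * (s * Q)"
      using compat by (intro mult_left_mono) auto
    finally show ?thesis by (simp add: power2_eq_square mult_ac)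
  qed
  then have "g * Q \<le> 4 * s * l\<^sup>2"
    using Q0 by (cases "Q = 0") (auto simp: mult_le_cancel_left)
  then show "(L2_set (mat_trans_mult n X d) {1..T})\<^sup>2 / real T \<le> 4 * real s * l\<^sup>2 / compat_sq n T s X"
    using g by (simp add: Q_def g_def field_simps)
  have "l * (g * (a + b)) \<le> l * (4 * s * l)"
  proof -
    \<comment> \<open>AM-GM: \<open>2 l a \<le> g a\<^sup>2 / s + s l\<^sup>2 / g\<close>, whose first term is at most \<open>Q\<close>.\<close>
    have "2 * l * s * (g * a) \<le> g\<^sup>2 * a\<^sup>2 + s\<^sup>2 * l\<^sup>2"
      using zero_le_power2[of "g * a - s * l"] by (simp add: power2_diff power_mult_distrib mult_ac)
    also have "\<dots> \<le> s * (g * Q) + s\<^sup>2 * l\<^sup>2"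
      using mult_left_mono[OF compat, of g] g by (simp add: power2_eq_square mult_ac)
    finally have "s * (2 * l * (g * a)) \<le> s * (g * Q + s * l\<^sup>2)"
      by (simp add: power2_eq_square algebra_simps)
    \<comment> \<open>The factor \<open>s\<close> can be cancelled only for \<open>s > 0\<close>;
      for \<open>s = 0\<close> the next inequality holds because its left side vanishes.\<close>
    moreover have "a = 0" if "s = 0"
      using compat that g by (simp add: mult_le_0_iff)
    ultimately have "2 * l * (g * a) \<le> g * Q + s * l\<^sup>2"
      using g Q0 by (cases "s = 0") auto
    \<comment> \<open>Adding \<open>l / 2 * (a + b)\<close> to both sides of \<open>basic\<close>
      removes \<open>b\<close> on the right and brings in the full norm of \<open>d\<close> on the
      left.\<close>
    moreover have "g * (Q + l / 2 * (a + b)) \<le> g * (2 * l * a)"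
      using g basic by (intro mult_left_mono) (auto simp: field_simps)
    moreover have "g * (2 * l * a) = 2 * l * (g * a)" by simp
    \<comment> \<open>The terms \<open>g * Q\<close> cancel. The result is sharper than the claim by
      a factor 2.\<close>
    ultimately have "g * (l / 2 * (a + b)) \<le> s * l\<^sup>2"
      unfolding distrib_left[of g] by linarith
    moreover have "0 \<le> s * l\<^sup>2" by simp
    moreover have "l * (g * (a + b)) = 2 * (g * (l / 2 * (a + b)))" by simp
    moreover have "l * (4 * s * l) = 4 * (s * l\<^sup>2)" by (simp add: power2_eq_square)
    ultimately show ?thesis by linarith
  qed
  then have "g * (a + b) \<le> 4 * s * l"
    using l_pos by simp
  then show "l1_norm {1..n} d \<le> 4 * real s * l / compat_sq n T s X"
    using g unfolding d1 g_def[symmetric] by (simp add: field_simps)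
qed

section \<open>From single outcomes to conditional probability\<close>

theorem proposition2:
  shows "\<exists>c0::real. c0 > 2 \<and>
    (\<forall>(M :: 'a measure) n T s nu phi phi_e x u e w D C alpha y lam ahat A.
       sparse_ar_regression M n T s nu phi phi_e x u e w D C alpha y \<longrightarrow>
       A \<in> sets M \<longrightarrow> measure M A > 0 \<longrightarrow>
       lasso_event n T s e (D T) y lam ahat A \<longrightarrow>
       (\<exists>E \<in> sets M. E \<subseteq> A \<and>
          measure M E / measure M A \<ge> 1 - 2 * exp (- (1 / 2) * (c0 - 2) * ln (real n)) \<and>
          (\<forall>\<omega>\<in>E.
             1 / real T * (L2_set (mat_trans_mult n (D T \<omega>) (\<lambda>i. ahat \<omega> i - alpha i)) {1..T})\<^sup>2
               \<le> 4 * real s * (lam \<omega>)\<^sup>2 / compat_sq n T s (D T \<omega>) \<and>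
             l1_norm {1..n} (\<lambda>i. ahat \<omega> i - alpha i)
               \<le> 4 * real s * lam \<omega> / compat_sq n T s (D T \<omega>))))"
\<comment> \<open>Any constant above 2 would serve as witness, since the event found has conditional
  probability 1.\<close>
proof (intro exI[of _ "3::real"] conjI allI impI)
  fix M :: "'a measure" and n T s nu phi phi_e x u e w D C alpha y lam ahat A
  assume model: "sparse_ar_regression M n T s nu phi phi_e x u e w D C alpha y"
    and A: "A \<in> sets M" "measure M A > 0" and lasso: "lasso_event n T s e (D T) y lam ahat A"
  interpret sparse_ar_regression M n T s nu phi phi_e x u e w D C alpha y
    by (fact model)
  \<comment> \<open>Each response equation has its own exceptional null set; finitely many of them
    combine into one, \<open>N\<close>.\<close>
  have "AE \<omega> in M. \<forall>t\<in>{1..T}. y t \<omega> = mat_trans_mult n (D T \<omega>) alpha t + e (int t) \<omega>"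
    by (rule AE_finite_allI) (use response in auto)
  then obtain N where N: "N \<in> null_sets M"
    and y: "{\<omega> \<in> space M. \<not> (\<forall>t\<in>{1..T}. y t \<omega> = mat_trans_mult n (D T \<omega>) alpha t + e (int t) \<omega>)} \<subseteq> N"
    by (auto simp: eventually_ae_filter)
  have bounds: "(L2_set (mat_trans_mult n (D T \<omega>) (\<lambda>i. ahat \<omega> i - alpha i)) {1..T})\<^sup>2 / real T
      \<le> 4 * real s * (lam \<omega>)\<^sup>2 / compat_sq n T s (D T \<omega>)"
    "l1_norm {1..n} (\<lambda>i. ahat \<omega> i - alpha i) \<le> 4 * real s * lam \<omega> / compat_sq n T s (D T \<omega>)"
    if \<omega>: "\<omega> \<in> A - N" for \<omega>
  proof -
    have "\<omega> \<in> space M" using \<omega> A(1) sets.sets_into_space by blast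
    then have eq: "y t \<omega> = mat_trans_mult n (D T \<omega>) alpha t + e (int t) \<omega>" if "t \<in> {1..T}" for t
      using y \<omega> that by blast
    have ev: "compat_sq n T s (D T \<omega>) > 0"
      "2 * linf_norm {1..n} (mat_mult T (D T \<omega>) (\<lambda>t. e (int t) \<omega>)) / real T \<le> lam \<omega>"
      "2 * linf_norm {1..n} (mat_mult T (D T \<omega>) (\<lambda>t. e (int t) \<omega>)) / real T > 0"
      "is_arg_min (lasso_objective n T (D T \<omega>) (\<lambda>t. y t \<omega>) (lam \<omega>)) (\<lambda>_. True) (ahat \<omega>)"
      using lasso \<omega> by (auto simp: lasso_event_def)
    \<comment> \<open>For \<open>T = 0\<close> the quotient in \<open>ev(3)\<close> would be 0 by
      the convention on division.\<close>
    have "0 < T" using ev(3) by (cases T) auto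
    moreover have "0 < lam \<omega>" using ev(2,3) by linarith
    ultimately show "(L2_set (mat_trans_mult n (D T \<omega>) (\<lambda>i. ahat \<omega> i - alpha i)) {1..T})\<^sup>2 / real T
        \<le> 4 * real s * (lam \<omega>)\<^sup>2 / compat_sq n T s (D T \<omega>)"
      "l1_norm {1..n} (\<lambda>i. ahat \<omega> i - alpha i) \<le> 4 * real s * lam \<omega> / compat_sq n T s (D T \<omega>)"
      using lasso_oracle_inequalities[OF _ sparse eq ev(1,2) _ ev(4)] by blast+
  qed
  have "measure M (A - N) = measure M A"
    using measure_Diff_null_set[OF A(1) N] .
  then have "measure M (A - N) / measure M A = 1"
    using A(2) by simp
  moreover have "A - N \<in> sets M" using A(1) N by auto
  ultimately show "\<exists>E \<in> sets M. E \<subseteq> A \<and>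
      measure M E / measure M A \<ge> 1 - 2 * exp (- (1 / 2) * (3 - 2) * ln (real n)) \<and>
      (\<forall>\<omega>\<in>E.
         1 / real T * (L2_set (mat_trans_mult n (D T \<omega>) (\<lambda>i. ahat \<omega> i - alpha i)) {1..T})\<^sup>2
           \<le> 4 * real s * (lam \<omega>)\<^sup>2 / compat_sq n T s (D T \<omega>) \<and>
         l1_norm {1..n} (\<lambda>i. ahat \<omega> i - alpha i)
           \<le> 4 * real s * lam \<omega> / compat_sq n T s (D T \<omega>))"
    using bounds by (intro bexI[of _ "A - N"]) auto
qed simp

end
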